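(* Let $q\ge 2$. If there exists a set of $s$ mutually orthogoval projective planes of order $q$, then $s(q^2+q+1)\le D(q^2+q+1,\,q+1,\,3)$. If there exists a set of $s$ mutually orthogoval affine planes of order $q$, then $s(q^2+q)\le D(q^2,\,q,\,3)$.
   Context: Two planes, both projective or both affine, of the same order and on the same point set are called orthogoval if every line of one plane intersects every line of the other in at most two points; a set of planes is mutually orthogoval if pairwise orthogoval. The packing number $D(v,k,t)$ is the maximum number of $k$-subsets (blocks) of a $v$-set such that every $t$-subset is contained in at most one block. *)

theory Defs
  imports Main
begin

text \<open>A plane on a point set \<open>V\<close> is given by its set \<open>L\<close> of lines, each line being the set of
  points incident with it.\<close>

definition linear_space :: "'a set \<Rightarrow> 'a set set \<Rightarrow> bool" where
  "linear_space V L \<longleftrightarrow>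
     (\<forall>l\<in>L. l \<subseteq> V) \<and>
     (\<forall>x\<in>V. \<forall>y\<in>V. x \<noteq> y \<longrightarrow> (\<exists>!l. l \<in> L \<and> x \<in> l \<and> y \<in> l))"

definition collinear :: "'a set set \<Rightarrow> 'a set \<Rightarrow> bool" where
  "collinear L S \<longleftrightarrow> (\<exists>l\<in>L. S \<subseteq> l)"

definition projective_plane :: "nat \<Rightarrow> 'a set \<Rightarrow> 'a set set \<Rightarrow> bool" where
  "projective_plane q V L \<longleftrightarrow>
     linear_space V L \<and>
     (\<forall>l\<in>L. \<forall>m\<in>L. l \<noteq> m \<longrightarrow> (\<exists>!x. x \<in> l \<inter> m)) \<and>
     (\<exists>Q. Q \<subseteq> V \<and> card Q = 4 \<and> (\<forall>S. S \<subseteq> Q \<and> card S = 3 \<longrightarrow> \<not> collinear L S)) \<and>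
     (\<forall>l\<in>L. card l = q + 1)"

definition affine_plane :: "nat \<Rightarrow> 'a set \<Rightarrow> 'a set set \<Rightarrow> bool" where
  "affine_plane q V L \<longleftrightarrow>
     linear_space V L \<and>
     (\<forall>l\<in>L. \<forall>x\<in>V. x \<notin> l \<longrightarrow> (\<exists>!m. m \<in> L \<and> x \<in> m \<and> m \<inter> l = {})) \<and>
     (\<exists>S. S \<subseteq> V \<and> card S = 3 \<and> \<not> collinear L S) \<and>
     (\<forall>l\<in>L. card l = q)"

definition orthogoval :: "'a set set \<Rightarrow> 'a set set \<Rightarrow> bool" where
  "orthogoval L M \<longleftrightarrow> (\<forall>l\<in>L. \<forall>m\<in>M. finite (l \<inter> m) \<and> card (l \<inter> m) \<le> 2)"

text \<open>The planes of a mutually orthogoval set are distinct, and only distinct members are compared.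
  This matters for affine planes of order 2, where every plane is trivially orthogoval to itself.\<close>

definition mutually_orthogoval_projective :: "nat \<Rightarrow> 'a set \<Rightarrow> 'a set set set \<Rightarrow> bool" where
  "mutually_orthogoval_projective q V P \<longleftrightarrow>
     (\<forall>L\<in>P. projective_plane q V L) \<and> pairwise orthogoval P"

definition mutually_orthogoval_affine :: "nat \<Rightarrow> 'a set \<Rightarrow> 'a set set set \<Rightarrow> bool" where
  "mutually_orthogoval_affine q V P \<longleftrightarrow>
     (\<forall>L\<in>P. affine_plane q V L) \<and> pairwise orthogoval P"

definition packing :: "'a set \<Rightarrow> nat \<Rightarrow> nat \<Rightarrow> 'a set set \<Rightarrow> bool" where
  "packing X k t B \<longleftrightarrow>
     (\<forall>b\<in>B. b \<subseteq> X \<and> card b = k) \<and>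
     (\<forall>T. T \<subseteq> X \<and> card T = t \<longrightarrow> (\<forall>b\<in>B. \<forall>c\<in>B. T \<subseteq> b \<and> T \<subseteq> c \<longrightarrow> b = c))"

text \<open>The maximum does not depend on the choice of the \<open>v\<close>-set, so we take \<open>{..<v}\<close>; it ranges over
  a finite set containing 0 (from the empty packing).\<close>

definition packing_number :: "nat \<Rightarrow> nat \<Rightarrow> nat \<Rightarrow> nat" where
  "packing_number v k t = Max {card B |B. packing {..<v} k t B}"

end

theory Submission
  imports Defs
begin

text \<open>Counting the lines through a point shows that each plane has \<open>q\<^sup>2 + q + 1\<close> lines
  (\<open>q\<^sup>2 + q\<close> in the affine case). Three points on a line of one plane cannot lie on a line of
  another plane of the set, nor on a second line of the same plane, so the lines of all the planes
  together form a packing. The planes share no line as soon as lines have at least three points; the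
  remaining case is the affine one of order 2, where all pairs of points are lines and hence there is
  only one plane.\<close>

section \<open>Lines through points in a linear space\<close>

definition pencil :: "'a set set \<Rightarrow> 'a \<Rightarrow> 'a set set" where
  "pencil L x = {m \<in> L. x \<in> m}"

text \<open>The description by \<open>THE\<close> has a meaning only for two distinct points of
  \<open>V\<close>, where \<open>linear_space\<close> supplies existence and uniqueness.\<close>

definition join :: "'a set set \<Rightarrow> 'a \<Rightarrow> 'a \<Rightarrow> 'a set" where
  "join L x y = (THE l. l \<in> L \<and> x \<in> l \<and> y \<in> l)"

lemma linear_space_line_subset: "linear_space V L \<Longrightarrow> l \<in> L \<Longrightarrow> l \<subseteq> V"
  by (simp add: linear_space_def)

lemma linear_space_unique:
  assumes "linear_space V L" "x \<noteq> y" "l \<in> L" "m \<in> L" "x \<in> l" "y \<in> l" "x \<in> m" "y \<in> m"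
  shows "l = m"
proof -
  have "x \<in> V" "y \<in> V"
    using assms linear_space_line_subset by blast+
  then have "\<exists>!l. l \<in> L \<and> x \<in> l \<and> y \<in> l"
    using assms(1,2) unfolding linear_space_def by blast
  with assms show ?thesis by blast
qed

lemma join:
  assumes "linear_space V L" "x \<in> V" "y \<in> V" "x \<noteq> y"
  shows "join L x y \<in> L" "x \<in> join L x y" "y \<in> join L x y"
proof -
  have "\<exists>!l. l \<in> L \<and> x \<in> l \<and> y \<in> l"
    using assms unfolding linear_space_def by blast
  from theI'[OF this]
  show "join L x y \<in> L" "x \<in> join L x y" "y \<in> join L x y"
    unfolding join_def by blast+
qed

text \<open>Suppose every line passed through \<open>x\<close>. Of three noncollinear points a, b,
  c, the line bc contains \<open>x\<close> but not a, so \<open>x\<close> differs from a. Then ab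
  and ac share the two points \<open>x\<close> and a, hence coincide and contain all three
  points.\<close>

lemma ex_line_avoiding:
  assumes ls: "linear_space V L" and S: "S \<subseteq> V" "card S = 3" "\<not> collinear L S"
  shows "\<exists>l\<in>L. x \<notin> l"
proof (rule ccontr)
  assume "\<not> (\<exists>l\<in>L. x \<notin> l)"
  then have all: "x \<in> l" if "l \<in> L" for l
    using that by blast
  obtain a b c where abc: "S = {a, b, c}" "a \<noteq> b" "a \<noteq> c" "b \<noteq> c"
    using S(2) by (auto simp: card_3_iff)
  then have V: "a \<in> V" "b \<in> V" "c \<in> V"
    using S(1) by auto
  have nc: "\<not> (a \<in> l \<and> b \<in> l \<and> c \<in> l)" if "l \<in> L" for l
    using that S(3) abc(1) unfolding collinear_def by auto
  note ab = join[OF ls V(1,2) abc(2)] and ac = join[OF ls V(1,3) abc(3)]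
    and bc = join[OF ls V(2,3) abc(4)]
  have "x \<noteq> a"
    using all[OF bc(1)] bc nc[OF bc(1)] by blast
  then have "join L a b = join L a c"
    using linear_space_unique[OF ls _ ab(1) ac(1), of x a] all[OF ab(1)] all[OF ac(1)] ab ac
    by blast
  then show False
    using nc[OF ab(1)] ab ac by simp
qed

text \<open>Joining \<open>x\<close> to the points of \<open>l\<close> gives a bijection from
  \<open>l\<close> to the lines through \<open>x\<close> that meet \<open>l\<close>. This yields the
  size of the pencils in both kinds of planes.\<close>

lemma card_pencil_meeting:
  assumes ls: "linear_space V L" and x: "x \<in> V" and l: "l \<in> L" "x \<notin> l"
  shows "card {m \<in> pencil L x. m \<inter> l \<noteq> {}} = card l"
proof -
  have V: "y \<in> V" "x \<noteq> y" if "y \<in> l" for y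
    using that l linear_space_line_subset[OF ls l(1)] by auto
  note j = join[OF ls x V]
  have "join L x ` l = {m \<in> pencil L x. m \<inter> l \<noteq> {}}"
  proof (intro equalityI subsetI)
    fix m assume "m \<in> join L x ` l"
    then show "m \<in> {m \<in> pencil L x. m \<inter> l \<noteq> {}}"
      using j unfolding pencil_def by blast
  next
    fix m assume "m \<in> {m \<in> pencil L x. m \<inter> l \<noteq> {}}"
    then obtain y where y: "y \<in> l" "y \<in> m" "m \<in> L" "x \<in> m"
      unfolding pencil_def by blast
    then have "m = join L x y"
      using linear_space_unique[OF ls V(2)[OF y(1)] y(3) j(1)[OF y(1) y(1)]] j[OF y(1) y(1)] by blast
    with y show "m \<in> join L x ` l" by blast
  qed
  moreover have "inj_on (join L x) l"
  proof (rule inj_onI, rule ccontr)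
    fix y z assume yz: "y \<in> l" "z \<in> l" "join L x y = join L x z" "y \<noteq> z"
    \<comment> \<open>A line through two points of \<open>l\<close> is \<open>l\<close> itself, yet
      a join with \<open>x\<close> contains \<open>x\<close>.\<close>
    have "join L x y = l"
      using linear_space_unique[OF ls yz(4) j(1)[OF yz(1) yz(1)] l(1)] j(3) yz by metis
    then show False
      using j(2)[OF yz(1) yz(1)] l(2) by simp
  qed
  ultimately show ?thesis
    using card_image by metis
qed

text \<open>The lines through a fixed point, with that point removed, partition the remaining
  points; this gives \<open>card V\<close>. Counting incident pairs of a point and a line in two
  ways then gives \<open>card L\<close>.\<close>

lemma linear_space_counting:
  assumes ls: "linear_space V L" and "V \<noteq> {}" and "k > 0" "r > 0"
    and k: "\<And>l. l \<in> L \<Longrightarrow> card l = k"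
    and r: "\<And>x. x \<in> V \<Longrightarrow> card (pencil L x) = r"
  shows "finite V" "card V = r * (k - 1) + 1" "card L * k = card V * r"
proof -
  obtain x where x: "x \<in> V" using \<open>V \<noteq> {}\<close> by blast
  \<comment> \<open>Infinite sets have \<open>card\<close> 0, so the positivity of \<open>k\<close>
    and \<open>r\<close> forces lines and pencils to be finite.\<close>
  have fl: "finite l" if "l \<in> L" for l
    using k[OF that] \<open>k > 0\<close> card_ge_0_finite[of l] by simp
  have fp: "finite (pencil L x)"
    using r[OF x] \<open>r > 0\<close> card_ge_0_finite[of "pencil L x"] by simp
  have V: "V - {x} = (\<Union>m\<in>pencil L x. m - {x})"
    using join[OF ls x] linear_space_line_subset[OF ls] unfolding pencil_def by blast
  have "finite (V - {x})"
    unfolding V using fp fl by (auto simp: pencil_def)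
  then show fV: "finite V" by simp
  have "card (V - {x}) = (\<Sum>m\<in>pencil L x. card (m - {x}))"
    unfolding V
  proof (rule card_UN_disjoint[OF fp])
    show "\<forall>m\<in>pencil L x. finite (m - {x})"
      using fl by (auto simp: pencil_def)
    show "\<forall>m\<in>pencil L x. \<forall>n\<in>pencil L x. m \<noteq> n \<longrightarrow> (m - {x}) \<inter> (n - {x}) = {}"
      using linear_space_unique[OF ls] unfolding pencil_def by blast
  qed
  also have "\<dots> = (\<Sum>m\<in>pencil L x. k - 1)"
    by (rule sum.cong) (auto simp: pencil_def k)
  also have "\<dots> = r * (k - 1)"
    using r[OF x] by simp
  finally show "card V = r * (k - 1) + 1"
    using card.remove[OF fV x] by simp
  have "L \<subseteq> Pow V"
    using linear_space_line_subset[OF ls] by blast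
  then have "finite L"
    using fV finite_subset by blast
  then have "(\<Sum>x\<in>V. card {l \<in> L. x \<in> l}) = k * card L"
  proof (rule sum_multicount[OF fV])
    show "\<forall>l\<in>L. card {x \<in> V. x \<in> l} = k"
    proof
      fix l assume l: "l \<in> L"
      then have "{x \<in> V. x \<in> l} = l"
        using linear_space_line_subset[OF ls] by blast
      with k[OF l] show "card {x \<in> V. x \<in> l} = k" by simp
    qed
  qed
  moreover have "(\<Sum>x\<in>V. card {l \<in> L. x \<in> l}) = card V * r"
    using r unfolding pencil_def by simp
  ultimately show "card L * k = card V * r" by simp
qed

section \<open>Numbers of points and lines in planes\<close>

lemma projective_plane_card:
  assumes pp: "projective_plane q V L"
  shows "finite V" "card V = q\<^sup>2 + q + 1" "card L = q\<^sup>2 + q + 1"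
proof -
  have k: "card l = q + 1" if "l \<in> L" for l
    using pp that unfolding projective_plane_def by simp
  have ls: "linear_space V L"
    using pp unfolding projective_plane_def by simp
  have "\<exists>Q. Q \<subseteq> V \<and> card Q = 4 \<and> (\<forall>S. S \<subseteq> Q \<and> card S = 3 \<longrightarrow> \<not> collinear L S)"
    using pp unfolding projective_plane_def by (elim conjE)
  then obtain Q where Q: "Q \<subseteq> V" "card Q = 4"
    "\<And>S. S \<subseteq> Q \<Longrightarrow> card S = 3 \<Longrightarrow> \<not> collinear L S"
    by (elim exE conjE) simp
  \<comment> \<open>Any three points of the quadrangle serve as the noncollinear triple for
    \<open>ex_line_avoiding\<close>.\<close>
  obtain S where S: "S \<subseteq> Q" "card S = 3"
    using Q(2) obtain_subset_with_card_n[of 3 Q] by auto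
  have r: "card (pencil L x) = q + 1" if x: "x \<in> V" for x
  proof -
    obtain l where l: "l \<in> L" "x \<notin> l"
      using ex_line_avoiding[OF ls subset_trans[OF S(1) Q(1)] S(2) Q(3)[OF S]] by blast
    \<comment> \<open>Any two lines meet, so the whole pencil at \<open>x\<close> is counted by the
      points of \<open>l\<close>.\<close>
    have "m \<inter> l \<noteq> {}" if "m \<in> pencil L x" for m
    proof -
      have "m \<in> L" "m \<noteq> l"
        using that l(2) unfolding pencil_def by auto
      then have "\<exists>!y. y \<in> m \<inter> l"
        using pp l(1) unfolding projective_plane_def by simp
      then show ?thesis by blast
    qed
    then have "{m \<in> pencil L x. m \<inter> l \<noteq> {}} = pencil L x" by blast
    then show ?thesis
      using card_pencil_meeting[OF ls x l] k[OF l(1)] by simp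
  qed
  have "V \<noteq> {}" using Q(1,2) by auto
  note * = linear_space_counting[OF ls this _ _ k r]
  show "finite V" using *(1) by simp
  show c: "card V = q\<^sup>2 + q + 1" using *(2) by (simp add: power2_eq_square)
  have "card L * (q + 1) = card V * (q + 1)" using *(3) by simp
  \<comment> \<open>Lines and pencils have the same size \<open>q + 1\<close>, which cancels in the
    incidence count.\<close>
  then have "card L = card V" by (simp only: mult_cancel2) simp
  then show "card L = q\<^sup>2 + q + 1" using c by simp
qed

lemma affine_plane_card:
  assumes ap: "affine_plane q V L" and "q > 0"
  shows "finite V" "card V = q\<^sup>2" "card L = q\<^sup>2 + q"
proof -
  have ls: "linear_space V L"
    using ap unfolding affine_plane_def by simp
  have k: "card l = q" if "l \<in> L" for l
    using ap that unfolding affine_plane_def by simp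
  obtain S where S: "S \<subseteq> V" "card S = 3" "\<not> collinear L S"
    using ap unfolding affine_plane_def by (elim conjE exE)
  have r: "card (pencil L x) = q + 1" if x: "x \<in> V" for x
  proof -
    obtain l where l: "l \<in> L" "x \<notin> l"
      using ex_line_avoiding[OF ls S] by blast
    then have "\<exists>!m. m \<in> L \<and> x \<in> m \<and> m \<inter> l = {}"
      using ap x unfolding affine_plane_def by simp
    then obtain m where m: "m \<in> L" "x \<in> m" "m \<inter> l = {}"
      "\<And>n. n \<in> L \<Longrightarrow> x \<in> n \<Longrightarrow> n \<inter> l = {} \<Longrightarrow> n = m"
      by blast
    \<comment> \<open>Exactly one line through \<open>x\<close> misses \<open>l\<close>, namely the
      parallel \<open>m\<close>; it adds one to the \<open>q\<close> lines that meet
      \<open>l\<close>.\<close>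
    have "pencil L x = insert m {m \<in> pencil L x. m \<inter> l \<noteq> {}}"
      using m unfolding pencil_def by blast
    moreover have c: "card {m \<in> pencil L x. m \<inter> l \<noteq> {}} = q"
      using card_pencil_meeting[OF ls x l] k[OF l(1)] by simp
    moreover have "finite {m \<in> pencil L x. m \<inter> l \<noteq> {}}"
      using c \<open>q > 0\<close> card_ge_0_finite by metis
    moreover have "m \<notin> {m \<in> pencil L x. m \<inter> l \<noteq> {}}"
      using m(3) by simp
    ultimately show ?thesis
      by (metis card_insert_disjoint Suc_eq_plus1)
  qed
  have "V \<noteq> {}" using S(1,2) by auto
  note * = linear_space_counting[OF ls this _ _ k r]
  show "finite V" using *(1) \<open>q > 0\<close> by simp
  have "card V = (q + 1) * (q - 1) + 1" using *(2) \<open>q > 0\<close> by simp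
  \<comment> \<open>Splitting on \<open>q\<close> removes the truncated subtraction
    \<open>q - 1\<close>.\<close>
  then show c: "card V = q\<^sup>2"
    using \<open>q > 0\<close> by (cases q) (simp_all add: power2_eq_square)
  have "card L * q = card V * (q + 1)" using *(3) \<open>q > 0\<close> by simp
  then have "card L * q = (q\<^sup>2 + q) * q" by (simp add: c power2_eq_square algebra_simps)
  then show "card L = q\<^sup>2 + q" using \<open>q > 0\<close> by simp
qed

text \<open>The join of two points has only two elements, so it is the pair itself. Hence the point
  set determines an affine plane of order 2.\<close>

lemma affine_plane_2_lines:
  assumes "affine_plane 2 V L"
  shows "L = {l. l \<subseteq> V \<and> card l = 2}"
proof (intro equalityI subsetI)
  fix l assume "l \<in> L"
  then show "l \<in> {l. l \<subseteq> V \<and> card l = 2}"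
    using assms unfolding affine_plane_def linear_space_def by blast
next
  fix l assume "l \<in> {l. l \<subseteq> V \<and> card l = 2}"
  then obtain x y where l: "l = {x, y}" "x \<noteq> y" "x \<in> V" "y \<in> V"
    by (auto simp: card_2_iff)
  have ls: "linear_space V L"
    using assms unfolding affine_plane_def by simp
  note j = join[OF ls l(3,4,2)]
  have c: "card (join L x y) = 2"
    using assms j(1) unfolding affine_plane_def by simp
  then have "finite (join L x y)"
    using card_ge_0_finite[of "join L x y"] by simp
  then have "l = join L x y"
    using card_subset_eq[of "join L x y" l] j(2,3) l(1,2) c by simp
  with j(1) show "l \<in> L" by simp
qed

section \<open>Packings and their transport to the standard point set\<close>

lemma packing_image:
  assumes inj: "inj_on f X" and B: "packing X k t B"
  shows "packing (f ` X) k t ((`) f ` B)"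
  unfolding packing_def
proof (intro conjI allI impI ballI)
  fix b assume "b \<in> (`) f ` B"
  then obtain b' where b': "b' \<in> B" "b = f ` b'" by blast
  then have "b' \<subseteq> X" "card b' = k" using B unfolding packing_def by auto
  then show "b \<subseteq> f ` X" "card b = k"
    using b'(2) card_image[OF inj_on_subset[OF inj]] by auto
next
  fix T b c
  assume T: "T \<subseteq> f ` X \<and> card T = t" and bc: "b \<in> (`) f ` B" "c \<in> (`) f ` B" "T \<subseteq> b \<and> T \<subseteq> c"
  obtain b' c' where "b' \<in> B" "b = f ` b'" "c' \<in> B" "c = f ` c'"
    using bc(1,2) by (elim imageE) simp
  moreover obtain U where "U \<subseteq> X" "T = f ` U"
    using T by (auto elim: subset_imageE)
  ultimately have *: "U \<subseteq> X" "T = f ` U" "b' \<in> B" "b = f ` b'" "c' \<in> B" "c = f ` c'"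
    by simp_all
  \<comment> \<open>Blocks lie in \<open>X\<close>, where \<open>inv_into X f\<close> undoes
    \<open>f\<close>, so an inclusion between images pulls back.\<close>
  have "U \<subseteq> A" if "f ` U \<subseteq> f ` A" "A \<in> B" for A
    using image_mono[OF that(1), of "inv_into X f"] inv_into_image_cancel[OF inj] *(1) that(2) B
    unfolding packing_def by simp
  then have "U \<subseteq> b'" "U \<subseteq> c'"
    using bc(3) *(2-6) by simp_all
  moreover have "card U = t"
    using T *(1,2) card_image[OF inj_on_subset[OF inj]] by auto
  ultimately have "b' = c'"
    using B *(1,3,5) unfolding packing_def by simp
  with * show "b = c" by simp
qed

lemma card_le_packing_number:
  assumes "finite X" and B: "packing X k t B"
  shows "card B \<le> packing_number (card X) k t"
proof -
  obtain f where f: "bij_betw f X {..<card X}"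
    using ex_bij_betw_finite_nat[OF \<open>finite X\<close>] by (auto simp: atLeast0LessThan)
  then have inj: "inj_on f X" and im: "f ` X = {..<card X}"
    unfolding bij_betw_def by auto
  have "B \<subseteq> Pow X"
    using B unfolding packing_def by blast
  then have "card ((`) f ` B) = card B"
    by (rule card_image[OF inj_on_subset[OF inj_on_image_Pow[OF inj]]])
  moreover have "packing {..<card X} k t ((`) f ` B)"
    using packing_image[OF inj B] im by simp
  ultimately have mem: "card B \<in> {card B |B. packing {..<card X} k t B}"
    by (intro CollectI exI[of _ "(`) f ` B"]) simp
  \<comment> \<open>All packings are families of subsets of one finite set, so only finitely many
    sizes occur and \<open>Max\<close> bounds each of them.\<close>
  have "{card B |B. packing {..<card X} k t B} \<subseteq> card ` Pow (Pow {..<card X})"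
    by (auto simp: packing_def)
  then have "finite {card B |B. packing {..<card X} k t B}"
    by (rule finite_subset) simp
  then show ?thesis
    unfolding packing_number_def using mem by (rule Max_ge)
qed

section \<open>The lines of mutually orthogoval planes\<close>

lemma packing_Union_orthogoval:
  assumes ls: "\<And>L. L \<in> P \<Longrightarrow> linear_space V L"
    and k: "\<And>L l. L \<in> P \<Longrightarrow> l \<in> L \<Longrightarrow> card l = k"
    and orth: "pairwise orthogoval P"
  shows "packing V k 3 (\<Union>P)"
  unfolding packing_def
proof (intro conjI allI impI ballI)
  fix b assume "b \<in> \<Union>P"
  then show "b \<subseteq> V" "card b = k"
    using linear_space_line_subset[OF ls] k by auto
next
  fix T b c
  assume T: "T \<subseteq> V \<and> card T = 3" and "b \<in> \<Union>P" "c \<in> \<Union>P" and bc: "T \<subseteq> b \<and> T \<subseteq> c"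
  then obtain L M where LM: "L \<in> P" "b \<in> L" "M \<in> P" "c \<in> M" by blast
  show "b = c"
  \<comment> \<open>Within one plane two points of \<open>T\<close> already determine the line; for
    distinct planes the three points of \<open>T\<close> exceed the allowed intersection.\<close>
  proof (cases "L = M")
    case True
    obtain x y where "x \<in> T" "y \<in> T" "x \<noteq> y"
      using T by (auto simp: card_3_iff)
    with bc show ?thesis
      using linear_space_unique[OF ls[OF LM(1)]] LM True by blast
  next
    case False
    then have "finite (b \<inter> c)" "card (b \<inter> c) \<le> 2"
      using orth LM unfolding pairwise_def orthogoval_def by auto
    then have "card T \<le> 2"
      using bc card_mono[of "b \<inter> c" T] by simp
    with T show ?thesis by simp
  qed
qed

text \<open>A line common to two distinct planes would meet itself in at least three points.\<close>

lemma disjoint_lines_orthogoval: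
  assumes k: "\<And>L l. L \<in> P \<Longrightarrow> l \<in> L \<Longrightarrow> card l \<ge> 3"
    and orth: "pairwise orthogoval P"
  shows "pairwise disjnt P"
proof (rule pairwiseI)
  fix L M assume LM: "L \<in> P" "M \<in> P" "L \<noteq> M"
  have "l \<notin> M" if "l \<in> L" for l
  proof
    assume "l \<in> M"
    then have "card (l \<inter> l) \<le> 2"
      using orth LM that unfolding pairwise_def orthogoval_def by blast
    with k[OF LM(1) that] show False by simp
  qed
  then show "disjnt L M" by (auto simp: disjnt_def)
qed

text \<open>Disjointness of the line sets keeps lines from being identified in the union, so the
  packing has \<open>card P * b\<close> blocks.\<close>

lemma packing_number_ge_orthogoval:
  assumes ls: "\<And>L. L \<in> P \<Longrightarrow> linear_space V L"
    and k: "\<And>L l. L \<in> P \<Longrightarrow> l \<in> L \<Longrightarrow> card l = k"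
    and b: "\<And>L. L \<in> P \<Longrightarrow> card L = b" and "finite V"
    and orth: "pairwise orthogoval P" and disj: "pairwise disjnt P"
  shows "card P * b \<le> packing_number (card V) k 3"
proof -
  have "L \<subseteq> Pow V" if "L \<in> P" for L
    using linear_space_line_subset[OF ls[OF that]] by blast
  then have "finite L" if "L \<in> P" for L
    using that \<open>finite V\<close> finite_subset by blast
  then have "card (\<Union>P) = sum card P"
    by (rule card_Union_disjoint[OF disj])
  also have "\<dots> = card P * b"
    using b by simp
  finally show ?thesis
    using card_le_packing_number[OF \<open>finite V\<close> packing_Union_orthogoval[OF ls k orth]] by simp
qed

section \<open>The bounds for projective and affine planes\<close>

lemma mutually_orthogoval_projective_le:
  assumes "q \<ge> 2" and P: "mutually_orthogoval_projective q V P"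
  shows "card P * (q\<^sup>2 + q + 1) \<le> packing_number (q\<^sup>2 + q + 1) (q + 1) 3"
\<comment> \<open>A member of \<open>P\<close> is what gives the finiteness and size of
  \<open>V\<close>; for empty \<open>P\<close> the left side is 0.\<close>
proof (cases "P = {}")
  case False
  then obtain L where L: "L \<in> P" by blast
  have pp: "projective_plane q V L" if "L \<in> P" for L
    using P that unfolding mutually_orthogoval_projective_def by blast
  have orth: "pairwise orthogoval P"
    using P unfolding mutually_orthogoval_projective_def by blast
  have ls: "linear_space V L" if "L \<in> P" for L
    using pp[OF that] unfolding projective_plane_def by simp
  have k: "card l = q + 1" if "L \<in> P" "l \<in> L" for L l
    using pp that unfolding projective_plane_def by simp
  have "pairwise disjnt P"
    using disjoint_lines_orthogoval[OF _ orth] k \<open>q \<ge> 2\<close> by simp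
  from packing_number_ge_orthogoval[OF ls k projective_plane_card(3)[OF pp]
      projective_plane_card(1)[OF pp[OF L]] orth this]
  show ?thesis
    using projective_plane_card(2)[OF pp[OF L]] by simp
qed simp

lemma mutually_orthogoval_affine_le:
  assumes "q \<ge> 2" and P: "mutually_orthogoval_affine q V P"
  shows "card P * (q\<^sup>2 + q) \<le> packing_number (q\<^sup>2) q 3"
proof (cases "P = {}")
  case False
  then obtain L where L: "L \<in> P" by blast
  have ap: "affine_plane q V L" if "L \<in> P" for L
    using P that unfolding mutually_orthogoval_affine_def by blast
  have orth: "pairwise orthogoval P"
    using P unfolding mutually_orthogoval_affine_def by blast
  have ls: "linear_space V L" if "L \<in> P" for L
    using ap[OF that] unfolding affine_plane_def by simp
  have k: "card l = q" if "L \<in> P" "l \<in> L" for L l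
    using ap that unfolding affine_plane_def by simp
  have "q > 0" using \<open>q \<ge> 2\<close> by simp
  have "pairwise disjnt P"
  \<comment> \<open>Lines with two points always satisfy the intersection bound, so for order 2
    disjointness comes instead from \<open>P\<close> having at most one member.\<close>
  proof (cases "q = 2")
    case True
    then have "L = M" if "L \<in> P" "M \<in> P" for L M
      using affine_plane_2_lines ap that by metis
    then show ?thesis by (auto simp: pairwise_def)
  next
    case False
    then show ?thesis
      using disjoint_lines_orthogoval[OF _ orth] k \<open>q \<ge> 2\<close> by simp
  qed
  from packing_number_ge_orthogoval[OF ls k affine_plane_card(3)[OF ap \<open>q > 0\<close>]
      affine_plane_card(1)[OF ap[OF L] \<open>q > 0\<close>] orth this]
  show ?thesis
    using affine_plane_card(2)[OF ap[OF L] \<open>q > 0\<close>] by simp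
qed simp

theorem theorem1p2:
  fixes q :: nat
  assumes "q \<ge> 2"
  shows "(\<forall>s. (\<exists>(V :: 'a set) P. mutually_orthogoval_projective q V P \<and> finite P \<and> card P = s)
            \<longrightarrow> s * (q^2 + q + 1) \<le> packing_number (q^2 + q + 1) (q + 1) 3)
       \<and> (\<forall>s. (\<exists>(V :: 'b set) P. mutually_orthogoval_affine q V P \<and> finite P \<and> card P = s)
            \<longrightarrow> s * (q^2 + q) \<le> packing_number (q^2) q 3)"
  using mutually_orthogoval_projective_le[OF assms] mutually_orthogoval_affine_le[OF assms] by blast

end
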